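(* For every $\tau\in\mathbb{H}^2$, $$\theta'[\tfrac23,\tfrac23]=\frac13\,\frac{\theta'[1,1]\,\theta^3[\frac13,\frac13]}{\theta^2[\frac23,\frac23]\,\theta[0,0]}\qquad\text{and}\qquad \theta'[\tfrac23,\tfrac43]=\frac13\,\frac{\theta'[1,1]\,\theta^3[\frac13,\frac53]}{\theta^2[\frac23,\frac43]\,\theta[0,0]}.$$
   Context: $\mathbb{H}^2=\{\tau\in\mathbb{C} : \Im\tau>0\}$ is the upper half plane. For $\epsilon,\epsilon'\in\mathbb{R}$, $\zeta\in\mathbb{C}$, $\tau\in\mathbb{H}^2$, the theta function with characteristics is $$\theta[\epsilon,\epsilon'](\zeta,\tau)=\sum_{n\in\mathbb{Z}}\exp\left(2\pi i\left[\tfrac12\left(n+\tfrac{\epsilon}{2}\right)^2\tau+\left(n+\tfrac{\epsilon}{2}\right)\left(\zeta+\tfrac{\epsilon'}{2}\right)\right]\right).$$ Write $\theta[\epsilon,\epsilon']=\theta[\epsilon,\epsilon'](0,\tau)$ and $\theta'[\epsilon,\epsilon']=\frac{\partial}{\partial\zeta}\theta[\epsilon,\epsilon'](\zeta,\tau)\big|_{\zeta=0}$; $\theta^k[\epsilon,\epsilon']$ means the $k$-th power of $\theta[\epsilon,\epsilon']$. *)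

theory Defs
  imports "HOL-Analysis.Analysis"
begin

text \<open>
  The theta function with characteristics. For \<open>Im \<tau> > 0\<close> the series converges absolutely, so
  the unordered sum over the integers is the intended value; for other \<open>\<tau>\<close> the value is
  irrelevant.
\<close>

definition theta :: "real \<Rightarrow> real \<Rightarrow> complex \<Rightarrow> complex \<Rightarrow> complex" where
  "theta \<epsilon> \<epsilon>' \<zeta> \<tau> =
     (\<Sum>\<^sub>\<infinity>n\<in>(UNIV :: int set).
        exp (2 * of_real pi * \<i> *
          (1 / 2 * (of_int n + of_real \<epsilon> / 2)\<^sup>2 * \<tau> +
           (of_int n + of_real \<epsilon> / 2) * (\<zeta> + of_real \<epsilon>' / 2))))"

definition theta_const :: "real \<Rightarrow> real \<Rightarrow> complex \<Rightarrow> complex" where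
  "theta_const \<epsilon> \<epsilon>' \<tau> = theta \<epsilon> \<epsilon>' 0 \<tau>"

definition theta_deriv :: "real \<Rightarrow> real \<Rightarrow> complex \<Rightarrow> complex" where
  "theta_deriv \<epsilon> \<epsilon>' \<tau> = deriv (\<lambda>\<zeta>. theta \<epsilon> \<epsilon>' \<zeta> \<tau>) 0"

end

theory Submission
  imports Defs "HOL-Complex_Analysis.Complex_Analysis"
begin

text \<open>
  Let \<open>h = theta 1 1\<close>, the odd theta function. Up to an exponential factor, \<open>theta \<epsilon> \<epsilon>' \<zeta>\<close> is
  \<open>h (\<zeta> + (\<epsilon> - 1) / 2 * \<tau> + (\<epsilon>' - 1) / 2)\<close>. With \<open>a = - (\<tau> + 1) / 6\<close> in the first identity and
  \<open>a = (1 - \<tau>) / 6\<close> in the second, the characteristic on the left belongs to \<open>a\<close>, the one of the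
  cube to \<open>2 * a\<close>, and \<open>[0, 0]\<close> to \<open>3 * a\<close>, up to a period in the second identity.

  The mechanism is Weierstrass's three-term identity for \<open>h\<close> (\<open>theta_11_three_term\<close>). It is a
  Pluecker relation, since \<open>h (x + y) * h (x - y)\<close> is a two-by-two determinant of theta series in
  \<open>x\<close> and \<open>y\<close> with modulus \<open>2 * \<tau>\<close> (\<open>theta_11_mult\<close>). A suitable choice of arguments gives
  \<open>h (2 * a) ^ 3 * h e = h (a + e/2) ^ 3 * h (3 * a - e/2) - h (3 * a + e/2) * h (a - e/2) ^ 3\<close>
  (\<open>theta_11_triplication\<close>),
  and its derivative at \<open>e = 0\<close>, rewritten with characteristics, is a formula for
  \<open>3 * T' 1 * T 1 ^ 2 * T 3 - T 1 ^ 3 * T' 3\<close> (\<open>theta_deriv_triplication\<close>), where \<open>T k\<close> and \<open>T' k\<close>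
  are the theta constant and the theta derivative that belong to \<open>k * a\<close>. The
  characteristic of \<open>3 * a\<close> is \<open>[0, 0]\<close> or \<open>[0, 2]\<close>. Both define the even function \<open>theta 0 0\<close>, so
  \<open>T' 3 = 0\<close> and the claim appears after division.

  The division needs that the theta constants in the denominators do not vanish, that is, that
  all zeros of \<open>h\<close> lie in the lattice spanned by \<open>1\<close> and \<open>\<tau>\<close> (\<open>theta_11_zeros\<close>). This also follows
  from the three-term identity: it forces a zero of \<open>h\<close> to be a quasi-period of \<open>h\<close>, and a
  quasi-period that is compatible with the known quasi-periods \<open>1\<close> and \<open>\<tau>\<close> lies in the lattice.
\<close>

section \<open>Convergence and holomorphy of the theta series\<close>

text \<open>
  The general term of the theta series, with the summation index replaced by a complex variable
  \<open>s\<close>. Changing the characteristic, reflecting the argument and passing from \<open>\<tau>\<close> to \<open>\<tau> / 2\<close>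
  then all become substitutions in one function.
\<close>

definition gauss :: "complex \<Rightarrow> complex \<Rightarrow> complex \<Rightarrow> complex" where
  "gauss \<tau> z s = exp (2 * of_real pi * \<i> * (1 / 2 * s\<^sup>2 * \<tau> + s * z))"

lemma theta_eq_gauss:
  "theta \<epsilon> \<epsilon>' \<zeta> \<tau> =
     (\<Sum>\<^sub>\<infinity>n\<in>(UNIV :: int set). gauss \<tau> (\<zeta> + of_real \<epsilon>' / 2) (of_int n + of_real \<epsilon> / 2))"
  unfolding theta_def gauss_def by simp

lemma summable_on_exp_minus_abs_int:
  "(\<lambda>n::int. exp (- real_of_int \<bar>n\<bar>)) summable_on UNIV"
proof -
  have "(\<lambda>n::nat. exp (- 1 :: real) ^ n) summable_on UNIV"
    by (rule summable_nonneg_imp_summable_on) (auto intro: summable_geometric)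
  then have nat: "(\<lambda>n::nat. exp (- real n)) summable_on UNIV"
    by (simp add: exp_of_nat_mult [symmetric])
  have pos: "(\<lambda>n::int. exp (- real_of_int \<bar>n\<bar>)) summable_on {0..}"
    by (rule iffD1 [OF summable_on_reindex_bij_witness
          [where i = nat and j = int and S = UNIV and g = "\<lambda>n::nat. exp (- real n)"]])
       (use nat in auto)
  have "(\<lambda>n::int. exp (- real_of_int \<bar>n\<bar>)) summable_on {..0}"
    by (rule iffD1 [OF summable_on_reindex_bij_witness
          [where i = uminus and j = uminus and S = "{0..}"
             and g = "\<lambda>n::int. exp (- real_of_int \<bar>n\<bar>)"]])
       (use pos in auto)
  then have neg: "(\<lambda>n::int. exp (- real_of_int \<bar>n\<bar>)) summable_on {..<0}"
    by (rule summable_on_subset_banach) auto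
  have "{0..} \<union> {..<0} = (UNIV :: int set)"
    by auto
  moreover have "{0..} \<inter> {..<0 :: int} = {}"
    by auto
  ultimately show ?thesis
    using summable_on_Un_disjoint [OF pos neg] by simp
qed

lemma norm_gauss_of_real:
  "norm (gauss \<tau> z (of_real r)) = exp (- pi * Im \<tau> * r\<^sup>2 - 2 * pi * r * Im z)"
  unfolding gauss_def by (simp add: power2_eq_square algebra_simps flip: of_real_mult)

text \<open>
  The bound is uniform on horizontal strips, which gives both the holomorphy of the sum and its
  termwise integration. Completing the square absorbs the linear part of the exponent
  into the Gaussian decay and leaves a surplus \<open>- \<bar>n\<bar>\<close>.
\<close>

lemma gauss_dominated:
  assumes "Im \<tau> > 0"
  obtains M :: "int \<Rightarrow> real" where "M summable_on UNIV"
    and "\<And>n z. \<bar>Im z\<bar> \<le> R \<Longrightarrow> norm (gauss \<tau> z (of_int n + of_real s)) \<le> M n"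
proof
  define t where "t = pi * Im \<tau>"
  (* The summand 1 is the surplus decay: the quadratic term has to dominate
     2 * pi * R * \<bar>r\<bar> and one more \<bar>r\<bar>. *)
  define b where "b = 2 * pi * \<bar>R\<bar> + 1"
  define C where "C = b\<^sup>2 / (4 * t) + \<bar>s\<bar>"
  have t: "t > 0"
    using assms by (simp add: t_def)
  show "(\<lambda>n. exp C * exp (- real_of_int \<bar>n\<bar>)) summable_on UNIV"
    by (intro summable_on_cmult_right summable_on_exp_minus_abs_int)
  fix n :: int and z :: complex
  assume z: "\<bar>Im z\<bar> \<le> R"
  define r where "r = real_of_int n + s"
  have "- (r * Im z) \<le> \<bar>r\<bar> * \<bar>R\<bar>"
    using z by (metis abs_ge_minus_self abs_ge_self abs_mult mult_left_mono abs_ge_zero order_trans)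
  then have "2 * pi * - (r * Im z) \<le> 2 * pi * (\<bar>r\<bar> * \<bar>R\<bar>)"
    by (intro mult_left_mono) auto
  then have 1: "- 2 * pi * r * Im z \<le> (b - 1) * \<bar>r\<bar>"
    by (simp add: b_def algebra_simps)
  have "0 \<le> t * (\<bar>r\<bar> - b / (2 * t))\<^sup>2"
    using t by simp
  also have "\<dots> = t * r\<^sup>2 - b * \<bar>r\<bar> + b\<^sup>2 / (4 * t)"
    using t by (simp add: power2_eq_square field_simps)
  finally have 2: "- t * r\<^sup>2 + b * \<bar>r\<bar> \<le> b\<^sup>2 / (4 * t)"
    by simp
  have 3: "\<bar>real_of_int n\<bar> - \<bar>s\<bar> \<le> \<bar>r\<bar>"
    unfolding r_def by simp
  have "- pi * Im \<tau> * r\<^sup>2 - 2 * pi * r * Im z \<le> C - \<bar>real_of_int n\<bar>"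
    using 1 2 3 unfolding C_def t_def by (simp add: algebra_simps)
  then have "norm (gauss \<tau> z (of_real r)) \<le> exp (C - \<bar>real_of_int n\<bar>)"
    unfolding norm_gauss_of_real by simp
  then show "norm (gauss \<tau> z (of_int n + of_real s)) \<le> exp C * exp (- real_of_int \<bar>n\<bar>)"
    by (simp add: r_def flip: exp_add)
qed

lemma gauss_abs_summable:
  assumes "Im \<tau> > 0"
  shows "(\<lambda>n::int. norm (gauss \<tau> z (of_int n + of_real s))) summable_on A"
proof -
  obtain M :: "int \<Rightarrow> real" where "M summable_on UNIV"
    and "\<And>n w. \<bar>Im w\<bar> \<le> \<bar>Im z\<bar> \<Longrightarrow> norm (gauss \<tau> w (of_int n + of_real s)) \<le> M n"
    using gauss_dominated [OF assms] by metis
  then have "(\<lambda>n::int. norm (gauss \<tau> z (of_int n + of_real s))) summable_on UNIV"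
    by (intro Infinite_Sum.abs_summable_on_comparison_test') auto
  then show ?thesis
    by (rule summable_on_subset_banach) auto
qed

lemma theta_holomorphic:
  assumes "Im \<tau> > 0"
  shows "(\<lambda>\<zeta>. theta \<epsilon> \<epsilon>' \<zeta> \<tau>) holomorphic_on S"
proof -
  have "(\<lambda>\<zeta>. theta \<epsilon> \<epsilon>' \<zeta> \<tau>) holomorphic_on ball 0 r" for r
  proof -
    obtain M :: "int \<Rightarrow> real" where M: "M summable_on UNIV"
      "\<And>n w. \<bar>Im w\<bar> \<le> r \<Longrightarrow> norm (gauss \<tau> w (of_int n + of_real (\<epsilon> / 2))) \<le> M n"
      using gauss_dominated [OF assms] by metis
    have "uniform_limit (cball 0 r)
        (\<lambda>X \<zeta>. \<Sum>n\<in>X. gauss \<tau> (\<zeta> + of_real \<epsilon>' / 2) (of_int n + of_real (\<epsilon> / 2)))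
        (\<lambda>\<zeta>. \<Sum>\<^sub>\<infinity>n\<in>(UNIV :: int set). gauss \<tau> (\<zeta> + of_real \<epsilon>' / 2) (of_int n + of_real (\<epsilon> / 2)))
        (finite_subsets_at_top UNIV)"
    proof (rule Weierstrass_m_test_general [OF M(2) M(1)])
      fix \<zeta> :: complex assume "\<zeta> \<in> cball 0 r"
      then show "\<bar>Im (\<zeta> + of_real \<epsilon>' / 2)\<bar> \<le> r"
        using abs_Im_le_cmod [of \<zeta>] by simp
    qed
    then show ?thesis
    proof (rule holomorphic_uniform_limit [rotated])
      show "\<forall>\<^sub>F X in finite_subsets_at_top UNIV.
          continuous_on (cball 0 r)
            (\<lambda>\<zeta>. \<Sum>n\<in>X. gauss \<tau> (\<zeta> + of_real \<epsilon>' / 2) (of_int n + of_real (\<epsilon> / 2))) \<and>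
          (\<lambda>\<zeta>. \<Sum>n\<in>X. gauss \<tau> (\<zeta> + of_real \<epsilon>' / 2) (of_int n + of_real (\<epsilon> / 2)))
            holomorphic_on ball 0 r"
        unfolding gauss_def
        by (intro always_eventually allI conjI continuous_intros holomorphic_intros)
    qed (auto simp: theta_eq_gauss)
  qed
  then have "(\<lambda>\<zeta>. theta \<epsilon> \<epsilon>' \<zeta> \<tau>) field_differentiable at z" for z
    by (rule holomorphic_on_imp_differentiable_at [where s = "ball 0 (norm z + 1)"]) auto
  then show ?thesis
    unfolding holomorphic_on_def by (simp add: field_differentiable_at_within)
qed

section \<open>Changing the characteristic\<close>

lemma gauss_shift:
  "gauss \<tau> z (s + d) = exp (2 * of_real pi * \<i> * (1 / 2 * d\<^sup>2 * \<tau> + d * z)) * gauss \<tau> (z + d * \<tau>) s"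
  unfolding gauss_def by (simp add: power2_eq_square algebra_simps flip: exp_add)

text \<open>
  A change of characteristic is a translation of \<open>\<zeta>\<close> by \<open>\<delta> / 2 * \<tau> + \<delta>' / 2\<close>, up to an exponential factor. For \<open>\<delta>\<close>
  and \<open>\<delta>'\<close> in \<open>{0, 2}\<close> the left-hand side is known by the next lemmas, and the quasi-periods \<open>\<tau>\<close> and
  \<open>1\<close> result.
\<close>

lemma theta_add_char:
  "theta (\<epsilon> + \<delta>) (\<epsilon>' + \<delta>') \<zeta> \<tau> =
     exp (2 * of_real pi * \<i> *
       (1 / 2 * (of_real \<delta> / 2)\<^sup>2 * \<tau> + of_real \<delta> / 2 * (\<zeta> + of_real (\<epsilon>' + \<delta>') / 2))) *
     theta \<epsilon> \<epsilon>' (\<zeta> + of_real \<delta> / 2 * \<tau> + of_real \<delta>' / 2) \<tau>"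
  unfolding theta_eq_gauss
proof (subst infsum_cmult_right' [symmetric], rule infsum_cong)
  fix n :: int
  have s: "of_int n + of_real (\<epsilon> + \<delta>) / 2 = of_int n + of_real \<epsilon> / 2 + of_real \<delta> / (2 :: complex)"
    and z: "\<zeta> + of_real (\<epsilon>' + \<delta>') / 2 + of_real \<delta> / 2 * \<tau> =
      \<zeta> + of_real \<delta> / 2 * \<tau> + of_real \<delta>' / 2 + of_real \<epsilon>' / 2"
    by (simp_all add: add_divide_distrib)
  show "gauss \<tau> (\<zeta> + of_real (\<epsilon>' + \<delta>') / 2) (of_int n + of_real (\<epsilon> + \<delta>) / 2) =
    exp (2 * of_real pi * \<i> *
       (1 / 2 * (of_real \<delta> / 2)\<^sup>2 * \<tau> + of_real \<delta> / 2 * (\<zeta> + of_real (\<epsilon>' + \<delta>') / 2))) *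
     gauss \<tau> (\<zeta> + of_real \<delta> / 2 * \<tau> + of_real \<delta>' / 2 + of_real \<epsilon>' / 2)
       (of_int n + of_real \<epsilon> / 2)"
    unfolding s gauss_shift z ..
qed

lemma theta_add_2_left: "theta (\<epsilon> + 2) \<epsilon>' \<zeta> \<tau> = theta \<epsilon> \<epsilon>' \<zeta> \<tau>"
  unfolding theta_eq_gauss
  by (rule infsum_reindex_bij_witness [where i = "\<lambda>n. n - 1" and j = "\<lambda>n. n + 1"])
     (auto simp: add_divide_distrib add_ac)

lemma exp_2pi_i_int: "exp (2 * of_real pi * \<i> * of_int n) = 1"
  using exp_integer_2pi [of "of_int n"] by (simp add: mult_ac)

lemma theta_add_2_right:
  "theta \<epsilon> (\<epsilon>' + 2) \<zeta> \<tau> = exp (of_real pi * \<i> * of_real \<epsilon>) * theta \<epsilon> \<epsilon>' \<zeta> \<tau>"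
  unfolding theta_eq_gauss
proof (subst infsum_cmult_right' [symmetric], rule infsum_cong)
  fix n :: int
  show "gauss \<tau> (\<zeta> + of_real (\<epsilon>' + 2) / 2) (of_int n + of_real \<epsilon> / 2) =
    exp (of_real pi * \<i> * of_real \<epsilon>) * gauss \<tau> (\<zeta> + of_real \<epsilon>' / 2) (of_int n + of_real \<epsilon> / 2)"
    (is "?l = ?e * ?g")
  proof -
    have "?l = exp (2 * of_real pi * \<i> * of_int n) * (?e * ?g)"
      unfolding gauss_def exp_add [symmetric]
      by (rule arg_cong [where f = exp]) (simp add: field_simps)
    then show ?thesis
      by (simp only: exp_2pi_i_int mult_1)
  qed
qed

lemma theta_minus: "theta (- \<epsilon>) (- \<epsilon>') (- \<zeta>) \<tau> = theta \<epsilon> \<epsilon>' \<zeta> \<tau>"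
  unfolding theta_eq_gauss
  by (rule infsum_reindex_bij_witness [where i = uminus and j = uminus])
     (auto simp: gauss_def power2_eq_square algebra_simps)

lemma theta_11_minus: "theta 1 1 (- \<zeta>) \<tau> = - theta 1 1 \<zeta> \<tau>"
proof -
  have "theta 1 1 \<zeta> \<tau> = theta (-1 + 2) (-1 + 2) \<zeta> \<tau>"
    by simp
  also have "\<dots> = exp (of_real pi * \<i> * of_real (- 1)) * theta (- 1) (- 1) \<zeta> \<tau>"
    by (subst theta_add_2_left, rule theta_add_2_right)
  also have "exp (of_real pi * \<i> * of_real (- 1)) = (- 1 :: complex)"
    by (simp add: exp_minus)
  also have "theta (- 1) (- 1) \<zeta> \<tau> = theta 1 1 (- \<zeta>) \<tau>"
    using theta_minus [of 1 1 "- \<zeta>" \<tau>] by simp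
  finally show ?thesis
    by simp
qed

section \<open>The three-term identity\<close>

lemma has_sum_product:
  fixes f g :: "_ \<Rightarrow> complex"
  assumes f: "(\<lambda>x. norm (f x)) summable_on A" and g: "(\<lambda>y. norm (g y)) summable_on B"
  shows "((\<lambda>(x, y). f x * g y) has_sum (infsum f A * infsum g B)) (A \<times> B)"
proof (rule has_sum_SigmaI)
  have "((\<lambda>y. norm (f x) * norm (g y)) has_sum (norm (f x) * infsum (\<lambda>y. norm (g y)) B)) B" for x
    by (intro has_sum_cmult_right has_sum_infsum g)
  moreover have "(\<lambda>x. norm (f x) * infsum (\<lambda>y. norm (g y)) B) summable_on A"
    by (intro summable_on_cmult_left f)
  ultimately have "(\<lambda>(x, y). norm (f x) * norm (g y)) summable_on A \<times> B"
    by (intro summable_on_SigmaI) auto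
  then have "(\<lambda>z. norm ((\<lambda>(x, y). f x * g y) z)) summable_on A \<times> B"
    by (simp add: case_prod_unfold norm_mult)
  then show "(\<lambda>(x, y). f x * g y) summable_on A \<times> B"
    by (rule abs_summable_summable)
qed (use assms in \<open>auto intro!: has_sum_cmult_right has_sum_cmult_left has_sum_infsum
       intro: abs_summable_summable\<close>)

definition theta_even :: "complex \<Rightarrow> complex \<Rightarrow> complex" where
  "theta_even \<tau> x = (\<Sum>\<^sub>\<infinity>p\<in>{p::int. even p}. gauss (\<tau> / 2) x (of_int p))"

definition theta_odd :: "complex \<Rightarrow> complex \<Rightarrow> complex" where
  "theta_odd \<tau> x = (\<Sum>\<^sub>\<infinity>p\<in>{p::int. odd p}. gauss (\<tau> / 2) x (of_int p))"

text \<open>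
  Multiply the two series and substitute \<open>p = m + n + 1\<close>, \<open>r = m - n\<close>. Since
  \<open>(m + 1/2)\<^sup>2 + (n + 1/2)\<^sup>2 = (p\<^sup>2 + r\<^sup>2) / 2\<close>, the variables \<open>x\<close> and \<open>y\<close> separate, and the only
  trace of the coupling is that \<open>p\<close> and \<open>r\<close> have opposite parity. The sign \<open>(-1)\<^sup>p\<close> comes from
  the second characteristic.
\<close>

lemma theta_11_mult:
  assumes "Im \<tau> > 0"
  shows "theta 1 1 (x + y) \<tau> * theta 1 1 (x - y) \<tau> =
     theta_even \<tau> x * theta_odd \<tau> y - theta_odd \<tau> x * theta_even \<tau> y"
proof -
  define F where "F = (\<lambda>(p::int, r::int).
    (if even p then 1 else -1) * (gauss (\<tau> / 2) x (of_int p) * gauss (\<tau> / 2) y (of_int r)))"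
  define E where "E = {p::int. even p}"
  define O' where "O' = {p::int. odd p}"
  have summ: "(\<lambda>p::int. norm (gauss (\<tau> / 2) z (of_int p))) summable_on A" for z A
    using gauss_abs_summable [of "\<tau> / 2" z 0 A] assms by simp
  have "(F has_sum (theta_even \<tau> x * theta_odd \<tau> y)) (E \<times> O')"
    unfolding F_def theta_even_def theta_odd_def E_def O'_def
    by (rule iffD1 [OF has_sum_cong has_sum_product [OF summ summ]]) auto
  moreover have "(F has_sum - (theta_odd \<tau> x * theta_even \<tau> y)) (O' \<times> E)"
    unfolding F_def theta_even_def theta_odd_def E_def O'_def
    by (rule iffD1 [OF has_sum_cong has_sum_uminusI [OF has_sum_product [OF summ summ]]]) auto
  ultimately have F: "(F has_sum (theta_even \<tau> x * theta_odd \<tau> y + - (theta_odd \<tau> x * theta_even \<tau> y)))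
     (E \<times> O' \<union> O' \<times> E)"
    by (rule has_sum_Un_disjoint) (auto simp: E_def O'_def)
  have prod: "((\<lambda>(m::int, n::int). gauss \<tau> (x + y + 1 / 2) (of_int m + 1 / 2) *
      gauss \<tau> (x - y + 1 / 2) (of_int n + 1 / 2)) has_sum
      (theta 1 1 (x + y) \<tau> * theta 1 1 (x - y) \<tau>)) (UNIV \<times> UNIV)"
    using has_sum_product [OF gauss_abs_summable [OF assms, of "x + y + 1 / 2" "1 / 2" UNIV]
        gauss_abs_summable [OF assms, of "x - y + 1 / 2" "1 / 2" UNIV]]
    by (simp add: theta_eq_gauss)
  have "((\<lambda>(m::int, n::int). gauss \<tau> (x + y + 1 / 2) (of_int m + 1 / 2) *
      gauss \<tau> (x - y + 1 / 2) (of_int n + 1 / 2)) has_sum S) (UNIV \<times> UNIV) \<longleftrightarrow>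
      (F has_sum S) (E \<times> O' \<union> O' \<times> E)" for S
  proof (rule has_sum_reindex_bij_witness
      [where j = "\<lambda>(m, n). (m + n + 1, m - n)"
         and i = "\<lambda>(p, r). ((p + r - 1) div 2, (p - r - 1) div 2)"])
    fix mn :: "int \<times> int"
    obtain m n where mn: "mn = (m, n)"
      by (cases mn)
    have "gauss \<tau> (x + y + 1 / 2) (of_int m + 1 / 2) * gauss \<tau> (x - y + 1 / 2) (of_int n + 1 / 2) =
      exp (of_real pi * \<i> * of_int (m + n + 1)) *
       (gauss (\<tau> / 2) x (of_int (m + n + 1)) * gauss (\<tau> / 2) y (of_int (m - n)))"
      unfolding gauss_def exp_add [symmetric]
      by (rule arg_cong [where f = exp]) (simp add: power2_eq_square field_simps)
    moreover have "exp (of_real pi * \<i> * of_int p) = (if even p then 1 else -1)" for p :: int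
    proof (cases "even p")
      case True
      then obtain k where "p = 2 * k" by blast
      then show ?thesis using exp_2pi_i_int [of k] by (simp add: mult_ac)
    next
      case False
      then obtain k where "p = 2 * k + 1" by (rule oddE)
      then show ?thesis using exp_2pi_i_int [of k] by (simp add: algebra_simps exp_add)
    qed
    ultimately show "F (case mn of (m, n) \<Rightarrow> (m + n + 1, m - n)) =
        (case mn of (m, n) \<Rightarrow> gauss \<tau> (x + y + 1 / 2) (of_int m + 1 / 2) *
          gauss \<tau> (x - y + 1 / 2) (of_int n + 1 / 2))"
      by (simp only: F_def mn prod.case)
  next
    fix mn :: "int \<times> int"
    show "(case mn of (m, n) \<Rightarrow> (m + n + 1, m - n)) \<in> E \<times> O' \<union> O' \<times> E"
      by (cases mn) (simp add: E_def O'_def, blast)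
  next
    fix pr :: "int \<times> int"
    assume "pr \<in> E \<times> O' \<union> O' \<times> E"
    moreover obtain p r where pr: "pr = (p, r)"
      by (cases pr)
    ultimately have "even p \<noteq> even r"
      by (auto simp: E_def O'_def)
    then have "(p + r - 1) div 2 + (p - r - 1) div 2 + 1 = p"
      "(p + r - 1) div 2 - (p - r - 1) div 2 = r"
      by presburger+
    then show "(case case pr of (p, r) \<Rightarrow> ((p + r - 1) div 2, (p - r - 1) div 2) of
        (m, n) \<Rightarrow> (m + n + 1, m - n)) = pr"
      by (simp add: pr)
  qed auto
  from has_sum_unique [OF iffD1 [OF this prod] F]
  have "theta 1 1 (x + y) \<tau> * theta 1 1 (x - y) \<tau> =
      theta_even \<tau> x * theta_odd \<tau> y + - (theta_odd \<tau> x * theta_even \<tau> y)"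
    .
  then show ?thesis
    by simp
qed

text \<open>
  Weierstrass's identity. The products \<open>h (x + y) * h (x - y)\<close> are the two-by-two minors of the
  matrix with rows \<open>theta_even\<close> and \<open>theta_odd\<close>, evaluated in four columns
  \<open>x, y, z, t\<close>, so this is the Pluecker relation between these minors.
\<close>

lemma theta_11_three_term:
  assumes "Im \<tau> > 0"
  defines "h \<equiv> \<lambda>z. theta 1 1 z \<tau>"
  shows "h (x + y) * h (x - y) * (h (z + t) * h (z - t)) +
         h (y + z) * h (y - z) * (h (x + t) * h (x - t)) +
         h (z + x) * h (z - x) * (h (y + t) * h (y - t)) = 0"
  unfolding h_def theta_11_mult [OF assms(1)] by (simp add: algebra_simps)

section \<open>Triplication\<close>

text \<open>
  The arguments of the three-term identity are chosen to make one product equal to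
  \<open>h (2 * a) ^ 3 * h e\<close>. The other two then have the form \<open>G e\<close> and \<open>- G (- e)\<close>, so that division by
  \<open>e\<close> turns both sides into derivatives as \<open>e\<close> tends to \<open>0\<close>.
\<close>

lemma theta_11_triplication:
  assumes "Im \<tau> > 0"
  defines "h \<equiv> \<lambda>z. theta 1 1 z \<tau>"
  shows "h (2 * a) ^ 3 * h e =
    h (a + e / 2) ^ 3 * h (3 * a - e / 2) - h (3 * a + e / 2) * h (a - e / 2) ^ 3"
proof -
  have m: "h (- z) = - h z" for z
    unfolding h_def by (rule theta_11_minus)
  have "h (2 * a) * h (2 * a) * (h (2 * a) * h e) +
      h (a + e / 2) * h (- (a + e / 2)) * (h (3 * a - e / 2) * h (a + e / 2)) +
      h (3 * a + e / 2) * h (- (a - e / 2)) * (h (a - e / 2) * h (- (a - e / 2))) = 0"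
    using theta_11_three_term [OF assms(1), of "2 * a" 0 "a + e / 2" "a - e / 2"]
    by (simp add: h_def algebra_simps)
  then show ?thesis
    unfolding m by (simp add: power3_eq_cube algebra_simps)
qed

lemma theta_has_field_derivative:
  assumes "Im \<tau> > 0"
  shows "((\<lambda>\<zeta>. theta \<epsilon> \<epsilon>' \<zeta> \<tau>) has_field_derivative theta_deriv \<epsilon> \<epsilon>' \<tau>) (at 0)"
  unfolding theta_deriv_def
  using theta_holomorphic [OF assms, of \<epsilon> \<epsilon>' UNIV]
  by (simp add: holomorphic_derivI)

text \<open>
  Here \<open>1 + k * x\<close>, \<open>1 + k * y\<close> is the characteristic that belongs to the point \<open>k * a\<close>,
  where \<open>a = x / 2 * \<tau> + y / 2\<close>. The
  exponential factors of all three terms agree because the exponents satisfy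
  \<open>3 * 2\<^sup>2 = 3 * 1\<^sup>2 + 3\<^sup>2\<close> in the quadratic and \<open>3 * 2 = 3 * 1 + 3\<close> in the linear part,
  while the contributions of \<open>e\<close> cancel.
\<close>

lemma theta_char_triplication:
  fixes x y :: real
  assumes "Im \<tau> > 0"
  defines "T \<equiv> \<lambda>k. theta (1 + k * x) (1 + k * y)"
  shows "T 2 0 \<tau> ^ 3 * T 0 e \<tau> =
    T 1 (e / 2) \<tau> ^ 3 * T 3 (- e / 2) \<tau> - T 3 (e / 2) \<tau> * T 1 (- e / 2) \<tau> ^ 3"
proof -
  define a where "a = of_real x / 2 * \<tau> + of_real y / 2"
  define c where "c = (\<lambda>k \<zeta>. 2 * of_real pi * \<i> *
       (1 / 2 * (of_real (k * x) / 2)\<^sup>2 * \<tau> + of_real (k * x) / 2 * (\<zeta> + of_real (1 + k * y) / 2)))"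
  have T: "T k \<zeta> \<tau> = exp (c k \<zeta>) * theta 1 1 (\<zeta> + of_real k * a) \<tau>" for k \<zeta>
    unfolding T_def c_def a_def theta_add_char by (simp add: algebra_simps)
  have c: "3 * c 1 (e / 2) + c 3 (- e / 2) = 3 * c 2 0" "3 * c 1 (- e / 2) + c 3 (e / 2) = 3 * c 2 0"
    "c 0 e = 0"
    unfolding c_def by (simp_all add: field_simps power2_eq_square)
  have e3: "exp (z :: complex) ^ 3 = exp (3 * z)" for z
    by (simp add: exp_of_nat_mult [of 3, simplified])
  have "T 1 (e / 2) \<tau> ^ 3 * T 3 (- e / 2) \<tau> - T 3 (e / 2) \<tau> * T 1 (- e / 2) \<tau> ^ 3 =
    exp (3 * c 1 (e / 2) + c 3 (- e / 2)) *
      (theta 1 1 (a + e / 2) \<tau> ^ 3 * theta 1 1 (3 * a - e / 2) \<tau>) -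
    exp (3 * c 1 (- e / 2) + c 3 (e / 2)) *
      (theta 1 1 (3 * a + e / 2) \<tau> * theta 1 1 (a - e / 2) \<tau> ^ 3)"
    unfolding T by (simp add: exp_add e3 power_mult_distrib add_ac mult_ac)
  also have "\<dots> = exp (3 * c 2 0) * (theta 1 1 (2 * a) \<tau> ^ 3 * theta 1 1 e \<tau>)"
    unfolding c theta_11_triplication [OF assms(1)] by (simp add: algebra_simps)
  also have "\<dots> = T 2 0 \<tau> ^ 3 * T 0 e \<tau>"
    unfolding T by (simp add: c e3 power_mult_distrib)
  finally show ?thesis ..
qed

text \<open>
  The derivative of the previous identity in \<open>e\<close> at \<open>0\<close>. Divided by \<open>T 1 ^ 3 * T 3\<close> it
  computes \<open>3 * L 1 - L 3\<close>, where \<open>L k = T' k / T k\<close>.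
\<close>

lemma theta_deriv_triplication:
  fixes x y :: real
  assumes "Im \<tau> > 0"
  defines "T \<equiv> \<lambda>k. theta_const (1 + k * x) (1 + k * y) \<tau>"
    and "T' \<equiv> \<lambda>k. theta_deriv (1 + k * x) (1 + k * y) \<tau>"
  shows "T' 0 * T 2 ^ 3 = 3 * T' 1 * T 1 ^ 2 * T 3 - T 1 ^ 3 * T' 3"
proof -
  define F where "F = (\<lambda>k \<zeta>. theta (1 + k * x) (1 + k * y) \<zeta> \<tau>)"
  have T: "T k = F k 0" for k
    by (simp add: T_def F_def theta_const_def)
  have F: "(F k has_field_derivative T' k) (at 0)" for k
    unfolding F_def T'_def by (rule theta_has_field_derivative [OF assms(1)])
  have plus: "((\<lambda>e. F k (e / 2)) has_field_derivative T' k * (1 / 2)) (at 0)" for k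
    by (rule DERIV_chain2 [where g = "\<lambda>e. e / 2"]) (auto intro!: derivative_eq_intros F)
  have minus: "((\<lambda>e. F k (- e / 2)) has_field_derivative T' k * (- 1 / 2)) (at 0)" for k
    by (rule DERIV_chain2 [where g = "\<lambda>e. - e / 2"]) (auto intro!: derivative_eq_intros F)
  have "((\<lambda>e. F 1 (e / 2) ^ 3 * F 3 (- e / 2) - F 3 (e / 2) * F 1 (- e / 2) ^ 3)
     has_field_derivative (3 * T' 1 * T 1 ^ 2 * T 3 - T 1 ^ 3 * T' 3)) (at 0)"
    by (rule derivative_eq_intros plus minus refl)+ (simp add: T algebra_simps)
  moreover have "((\<lambda>e. F 2 0 ^ 3 * F 0 e) has_field_derivative F 2 0 ^ 3 * T' 0) (at 0)"
    by (rule DERIV_cmult [OF F])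
  moreover have "(\<lambda>e. F 2 0 ^ 3 * F 0 e) =
      (\<lambda>e. F 1 (e / 2) ^ 3 * F 3 (- e / 2) - F 3 (e / 2) * F 1 (- e / 2) ^ 3)"
    using theta_char_triplication [OF assms(1), of x y] by (auto simp: F_def)
  ultimately have "F 2 0 ^ 3 * T' 0 = 3 * T' 1 * T 1 ^ 2 * T 3 - T 1 ^ 3 * T' 3"
    by (simp add: DERIV_unique)
  then show ?thesis
    by (simp add: T mult_ac)
qed

lemma theta_deriv_00:
  assumes "Im \<tau> > 0"
  shows "theta_deriv 0 0 \<tau> = 0"
proof -
  have "((\<lambda>\<zeta>. theta 0 0 (- \<zeta>) \<tau>) has_field_derivative theta_deriv 0 0 \<tau> * (- 1)) (at 0)"
    by (rule DERIV_chain2 [where g = uminus])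
       (auto intro!: derivative_eq_intros theta_has_field_derivative assms)
  moreover have "(\<lambda>\<zeta>. theta 0 0 (- \<zeta>) \<tau>) = (\<lambda>\<zeta>. theta 0 0 \<zeta> \<tau>)"
    using theta_minus [of 0 0 _ \<tau>] by simp
  ultimately have "theta_deriv 0 0 \<tau> * (- 1) = theta_deriv 0 0 \<tau>"
    using DERIV_unique [OF _ theta_has_field_derivative [OF assms]] by metis
  then show ?thesis
    by (simp add: complex_eq_iff)
qed

lemma theta_02: "theta 0 2 = theta 0 0"
  using theta_add_2_right [of 0 0] by (intro ext) simp

section \<open>The zeros of the odd theta function\<close>

lemma has_integral_exp_2pi_i_int:
  "((\<lambda>t. exp (2 * of_real pi * \<i> * of_int n * of_real t)) has_integral (if n = 0 then 1 else 0)) {0..1}"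
proof (cases "n = 0")
  case False
  define c where "c = 2 * of_real pi * \<i> * of_int n"
  have c: "c \<noteq> 0"
    using False by (simp add: c_def)
  have "((\<lambda>t. exp (c * of_real t)) has_integral
      (exp (c * of_real 1) / c - exp (c * of_real 0) / c)) {0..1}"
  proof (rule fundamental_theorem_of_calculus)
    fix t :: real
    have "((\<lambda>z. exp (c * z) / c) has_field_derivative exp (c * of_real t)) (at (of_real t))"
      using c by (auto intro!: derivative_eq_intros)
    then show "((\<lambda>t. exp (c * of_real t) / c) has_vector_derivative exp (c * of_real t))
        (at t within {0..1})"
      by (rule has_vector_derivative_real_field)
  qed simp
  moreover have "exp c = 1"
    unfolding c_def by (rule exp_2pi_i_int)
  ultimately show ?thesis
    using False by (simp add: c_def)
qed (use has_integral_const_real [of "1 :: complex" 0 1] in simp)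

text \<open>
  After multiplication with \<open>exp (- \<pi> \<i> t)\<close> the series is a Fourier series on \<open>[0, 1]\<close>, whose
  constant coefficient is the term with \<open>n = 0\<close> and does not vanish.
\<close>

lemma theta_11_not_identically_zero:
  assumes "Im \<tau> > 0"
  obtains z where "theta 1 1 z \<tau> \<noteq> 0"
proof (rule ccontr)
  assume "\<not> thesis"
  then have zero: "theta 1 1 z \<tau> = 0" for z
    using that by blast
  define f where "f = (\<lambda>(n::int) (t::real).
    gauss \<tau> (of_real t + 1 / 2) (of_int n + 1 / 2) * exp (- (of_real pi * \<i> * of_real t)))"
  have f: "f n t = gauss \<tau> (1 / 2) (of_int n + 1 / 2) * exp (2 * of_real pi * \<i> * of_int n * of_real t)"
    for n t
    unfolding f_def gauss_def exp_add [symmetric]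
    by (rule arg_cong [where f = exp]) (simp add: field_simps)
  obtain M :: "int \<Rightarrow> real" where M: "M summable_on UNIV"
    "\<And>n w. \<bar>Im w\<bar> \<le> 0 \<Longrightarrow> norm (gauss \<tau> w (of_int n + of_real (1 / 2))) \<le> M n"
    using gauss_dominated [OF assms] by metis
  have "uniform_limit {0..1} (\<lambda>X t. \<Sum>n\<in>X. f n t) (\<lambda>t. \<Sum>\<^sub>\<infinity>n\<in>UNIV. f n t)
      (finite_subsets_at_top UNIV)"
  proof (rule Weierstrass_m_test_general)
    show "norm (f n t) \<le> M n" for n t
      using M(2) [of "of_real t + 1 / 2" n] by (simp add: f_def norm_mult)
  qed (rule M)
  moreover have "(\<Sum>\<^sub>\<infinity>n\<in>UNIV. f n t) = 0" for t
  proof -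
    have "(\<Sum>\<^sub>\<infinity>n\<in>UNIV. f n t) = theta 1 1 (of_real t) \<tau> * exp (- (of_real pi * \<i> * of_real t))"
      unfolding f_def theta_eq_gauss by (simp add: infsum_cmult_left')
    then show ?thesis
      by (simp add: zero)
  qed
  ultimately have "uniform_limit {0..1} (\<lambda>X t. \<Sum>n\<in>X. f n t) (\<lambda>t. 0) (finite_subsets_at_top UNIV)"
    by simp
  then obtain I J where I: "\<And>X. ((\<lambda>t. \<Sum>n\<in>X. f n t) has_integral I X) {0..1}"
    and J: "((\<lambda>t. 0 :: complex) has_integral J) {0..1::real}"
    and lim: "(I \<longlongrightarrow> J) (finite_subsets_at_top UNIV)"
    by (rule uniform_limit_integral) (auto simp: f intro!: continuous_intros)
  have "J = 0"
    using J by simp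
  have "I X = gauss \<tau> (1 / 2) (1 / 2)" if "finite X" "0 \<in> X" for X
  proof -
    have "((\<lambda>t. \<Sum>n\<in>X. f n t) has_integral
        (\<Sum>n\<in>X. gauss \<tau> (1 / 2) (of_int n + 1 / 2) * (if n = 0 then 1 else 0))) {0..1}"
      unfolding f by (intro has_integral_sum has_integral_mult_right has_integral_exp_2pi_i_int that)
    then have "I X = (\<Sum>n\<in>X. gauss \<tau> (1 / 2) (of_int n + 1 / 2) * (if n = 0 then 1 else 0))"
      using I has_integral_unique by blast
    also have "\<dots> = gauss \<tau> (1 / 2) (1 / 2)"
      using that by (simp add: if_distrib cong: if_cong)
    finally show ?thesis .
  qed
  then have "\<forall>\<^sub>F X in finite_subsets_at_top UNIV. I X = gauss \<tau> (1 / 2) (1 / 2)"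
    unfolding eventually_finite_subsets_at_top by (intro exI [of _ "{0}"]) auto
  then have "(I \<longlongrightarrow> gauss \<tau> (1 / 2) (1 / 2)) (finite_subsets_at_top UNIV)"
    by (rule tendsto_eventually)
  then have "gauss \<tau> (1 / 2) (1 / 2) = 0"
    using lim \<open>J = 0\<close> tendsto_unique finite_subsets_at_top_neq_bot by metis
  then show False
    by (simp add: gauss_def)
qed

lemma theta_11_add_1: "theta 1 1 (z + 1) \<tau> = - theta 1 1 z \<tau>"
proof -
  have "theta 1 (1 + 2) z \<tau> = theta 1 1 (z + 1) \<tau>"
    using theta_add_char [of 1 0 1 2 z \<tau>] by simp
  then show ?thesis
    using theta_add_2_right [of 1 1 z \<tau>] by simp
qed

lemma theta_11_add_tau:
  "theta 1 1 (z + \<tau>) \<tau> = - exp (- (2 * of_real pi * \<i> * (\<tau> / 2 + z))) * theta 1 1 z \<tau>"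
proof -
  have "theta 1 1 z \<tau> = theta (1 + 2) (1 + 0) z \<tau>"
    by (simp only: theta_add_2_left add_0_right)
  also have "\<dots> = exp (2 * of_real pi * \<i> * (\<tau> / 2 + z) + of_real pi * \<i>) * theta 1 1 (z + \<tau>) \<tau>"
    unfolding theta_add_char by (simp add: algebra_simps)
  also have "\<dots> = - exp (2 * of_real pi * \<i> * (\<tau> / 2 + z)) * theta 1 1 (z + \<tau>) \<tau>"
    by (simp add: exp_add)
  finally show ?thesis
    by (simp add: exp_minus)
qed

text \<open>
  A zero \<open>a\<close> kills one term of the three-term identity. What remains says that
  \<open>g u = h (u + a) / h u\<close> satisfies \<open>g (u + d) * g (v - d) = g u * g v\<close>, so the logarithmic
  derivative of \<open>g\<close> is constant and \<open>g\<close> is an exponential.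
\<close>

lemma theta_11_zero_imp_quasi_period:
  assumes "Im \<tau> > 0" and "theta 1 1 a \<tau> = 0"
  obtains c k where "c \<noteq> 0" and "\<And>u. theta 1 1 (u + a) \<tau> = c * exp (k * u) * theta 1 1 u \<tau>"
proof -
  define h where "h = (\<lambda>z. theta 1 1 z \<tau>)"
  have hol: "h holomorphic_on S" for S
    unfolding h_def by (rule theta_holomorphic [OF assms(1)])
  have hol_shift: "(\<lambda>z. h (z + a)) holomorphic_on S" for S
    using holomorphic_on_compose [of "\<lambda>z. z + a" S h, OF _ hol]
    by (simp add: o_def holomorphic_on_add)
  have D: "(h has_field_derivative deriv h z) (at z)" for z
    using hol [of UNIV] by (simp add: holomorphic_derivI)
  have minus: "h (- z) = - h z" for z
    unfolding h_def by (rule theta_11_minus)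
  have cross: "h (u + a) * h (v + a) * (h (u + d) * h (v - d)) =
      h u * h v * (h (u + a + d) * h (v + a - d))" for u v d
  proof -
    define y z where "y = (u + v) / 2" and "z = (u - v) / 2"
    have uv: "u = y + z" "v = y - z"
      by (simp_all add: y_def z_def field_simps)
    have "h (y + a + y) * h (y + a - y) * (h (z + (z + d)) * h (z - (z + d))) +
        h (y + z) * h (y - z) * (h (y + a + (z + d)) * h (y + a - (z + d))) +
        h (z + (y + a)) * h (z - (y + a)) * (h (y + (z + d)) * h (y - (z + d))) = 0"
      unfolding h_def by (rule theta_11_three_term [OF assms(1)])
    moreover have "y + z = u" "y - z = v" "y + a + (z + d) = u + a + d" "y + a - (z + d) = v + a - d"
      "z + (y + a) = u + a" "z - (y + a) = - (v + a)" "y + (z + d) = u + d" "y - (z + d) = v - d"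
      by (simp_all add: uv)
    moreover have "h (y + a - y) = 0"
      using assms(2) by (simp add: h_def)
    ultimately have "h u * h v * (h (u + a + d) * h (v + a - d)) +
        h (u + a) * - h (v + a) * (h (u + d) * h (v - d)) = 0"
      by (simp only: minus mult_zero_left mult_zero_right add_0_left)
    then show ?thesis
      by simp
  qed
  (* W / (h u * h (u + a)) is the logarithmic derivative of g; comparing the derivatives of both
     sides of the previous identity at d = 0 shows that it takes the same value at u and v. *)
  define W where "W = (\<lambda>u. deriv h (u + a) * h u - h (u + a) * deriv h u)"
  have W: "W u * (h v * h (v + a)) = h u * h (u + a) * W v" for u v
  proof -
    have plus: "((\<lambda>d. h (u + d)) has_field_derivative deriv h u) (at 0)" for u
      using DERIV_shift [of h "deriv h u" 0 u] D [of u] by (simp add: add_ac)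
    have min: "((\<lambda>d. h (v - d)) has_field_derivative - deriv h v) (at 0)" for v
    proof -
      have "((\<lambda>d. v - d) has_field_derivative - 1) (at 0)"
        by (auto intro!: derivative_eq_intros)
      from DERIV_chain2 [OF _ this, of h "deriv h v"] show ?thesis
        using D [of v] by simp
    qed
    have "((\<lambda>d. h (u + a) * h (v + a) * (h (u + d) * h (v - d))) has_field_derivative
        h (u + a) * h (v + a) * (deriv h u * h v - h u * deriv h v)) (at 0)"
      by (rule derivative_eq_intros plus min refl)+ (simp add: algebra_simps)
    moreover have "((\<lambda>d. h u * h v * (h (u + a + d) * h (v + a - d))) has_field_derivative
        h u * h v * (deriv h (u + a) * h (v + a) - h (u + a) * deriv h (v + a))) (at 0)"
      by (rule derivative_eq_intros plus min refl)+ (simp add: algebra_simps)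
    ultimately have "h (u + a) * h (v + a) * (deriv h u * h v - h u * deriv h v) =
        h u * h v * (deriv h (u + a) * h (v + a) - h (u + a) * deriv h (v + a))"
      unfolding cross by (rule DERIV_unique)
    then show ?thesis
      unfolding W_def by (simp add: algebra_simps)
  qed
  have cont: "continuous_on UNIV h" "continuous_on UNIV (\<lambda>z. h (z + a))"
    using hol hol_shift by (auto intro: holomorphic_on_imp_continuous_on)
  (* The identity theorem excludes that the two holomorphic factors have a vanishing product. *)
  obtain v where v: "h v \<noteq> 0" "h (v + a) \<noteq> 0"
  proof (rule ccontr)
    assume "\<not> thesis"
    then have prod: "h z = 0 \<or> h (z + a) = 0" for z
      using that by blast
    obtain w where w: "h w \<noteq> 0"
      using theta_11_not_identically_zero [OF assms(1)] h_def by metis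
    have "open {z. h z \<noteq> 0}"
      using open_Collect_neq [OF cont(1) continuous_on_const] by simp
    then have "h ((w - a) + a) = 0"
      by (rule analytic_continuation_open [where s' = UNIV and g = "\<lambda>z. 0"])
         (use prod w hol_shift in auto)
    with w show False
      by simp
  qed
  define k where "k = W v / (h v * h (v + a))"
  have k: "W u = k * (h u * h (u + a))" for u
    using W [of u v] v by (simp add: k_def field_simps)
  define U where "U = {z. h z \<noteq> 0}"
  have "open U"
    using open_Collect_neq [OF cont(1) continuous_on_const] by (simp add: U_def)
  then obtain r where r: "r > 0" "ball v r \<subseteq> U"
    using v by (auto simp: U_def elim!: openE)
  define q where "q = (\<lambda>z. h (z + a) * exp (- (k * z)) / h z)"
  have "(q has_field_derivative 0) (at z within ball v r)" if "z \<in> ball v r" for z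
  proof -
    have nz: "h z \<noteq> 0"
      using that r by (auto simp: U_def)
    have shift: "((\<lambda>z. h (z + a)) has_field_derivative deriv h (z + a)) (at z)"
      using DERIV_shift [of h "deriv h (z + a)" z a] D by simp
    have "(q has_field_derivative (exp (- (k * z)) * (W z - k * (h z * h (z + a))) / (h z * h z))) (at z)"
      unfolding q_def W_def
      by (rule derivative_eq_intros shift D refl nz)+ (simp add: algebra_simps)
    then show ?thesis
      by (simp add: k has_field_derivative_at_within)
  qed
  then obtain c where c: "\<And>z. z \<in> ball v r \<Longrightarrow> q z = c"
    using has_field_derivative_zero_constant [OF convex_ball] by metis
  have near: "h (z + a) = c * exp (k * z) * h z" if "z \<in> ball v r" for z
  proof -
    have "h z \<noteq> 0"
      using that r by (auto simp: U_def)
    with c [OF that] show ?thesis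
      by (simp add: q_def exp_minus field_simps)
  qed
  (* Both sides are entire, so the zeros of h outside the ball do no harm. *)
  have "h (u + a) = c * exp (k * u) * h u" for u
    by (rule analytic_continuation_open [where s = "ball v r" and s' = UNIV])
       (use r near in \<open>auto intro!: hol_shift holomorphic_intros hol\<close>)
  moreover have "c \<noteq> 0"
    using near [of v] v r by auto
  ultimately show thesis
    using that [of c k] unfolding h_def by blast
qed

lemma exp_eq_1_imp_int:
  assumes "exp z = 1"
  shows "\<exists>n::int. z = 2 * of_real pi * \<i> * of_int n"
proof -
  obtain n :: int where "Re z = 0" "Im z = of_int (2 * n) * pi"
    using assms by (auto simp: exp_eq_1)
  then have "z = 2 * of_real pi * \<i> * of_int n"
    by (simp add: complex_eq_iff)
  then show ?thesis ..
qed

text \<open>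
  Translations by \<open>a\<close> and by \<open>d\<close> commute. If both multiply \<open>h\<close> by a factor, then the two ways to
  reach \<open>v + a + d\<close> from \<open>v\<close> give a relation between the factors.
\<close>

lemma quasi_period_multipliers:
  fixes h :: "complex \<Rightarrow> complex"
  assumes period: "\<And>u. h (u + a) = c * exp (k * u) * h u" and nz: "c \<noteq> 0" "h v \<noteq> 0"
    and d: "h (v + d) = r * h v" "h (v + a + d) = s * h (v + a)"
  shows "exp (k * d) * r = s"
proof -
  define X where "X = c * exp (k * v) * h v"
  have "X * s = h (v + a + d)"
    by (simp only: d(2) period X_def mult_ac)
  also have "v + a + d = v + d + a"
    by simp
  also have "h (v + d + a) = X * (exp (k * d) * r)"
  proof -
    have "exp (k * (v + d)) = exp (k * v) * exp (k * d)"
      by (simp add: distrib_left exp_add)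
    then show ?thesis
      by (simp only: period d(1) X_def mult_ac)
  qed
  finally show ?thesis
    using nz by (simp add: X_def)
qed

text \<open>
  By the previous lemmas translation by a zero \<open>a\<close> multiplies theta by \<open>c * exp (k * u)\<close>.
  Commuting it with the translation by \<open>1\<close> gives \<open>exp k = 1\<close>, so \<open>k = 2 \<pi> \<i> m\<close>; commuting it with
  the translation by \<open>\<tau>\<close> gives \<open>exp (k * \<tau>) = exp (- 2 \<pi> \<i> a)\<close>, so \<open>m * \<tau> + a\<close> is an integer.
\<close>

lemma theta_11_zeros:
  assumes "Im \<tau> > 0" and "theta 1 1 a \<tau> = 0"
  obtains m n :: int where "a = of_int m * \<tau> + of_int n"
proof -
  obtain c k where c: "c \<noteq> 0"
    and quasi: "\<And>u. theta 1 1 (u + a) \<tau> = c * exp (k * u) * theta 1 1 u \<tau>"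
    using theta_11_zero_imp_quasi_period [OF assms] by blast
  obtain v where v: "theta 1 1 v \<tau> \<noteq> 0"
    using theta_11_not_identically_zero [OF assms(1)] by blast
  note mult = quasi_period_multipliers [where h = "\<lambda>z. theta 1 1 z \<tau>", OF quasi c v]
  have "exp (k * 1) * - 1 = - 1"
    by (rule mult) (simp_all add: theta_11_add_1)
  then obtain m :: int where m: "k = 2 * of_real pi * \<i> * of_int m"
    using exp_eq_1_imp_int [of k] by auto
  define e where "e = - exp (- (2 * of_real pi * \<i> * (\<tau> / 2 + v)))"
  have "- exp (- (2 * of_real pi * \<i> * (\<tau> / 2 + (v + a)))) = e * exp (- (2 * of_real pi * \<i> * a))"
    unfolding e_def mult_minus_left exp_add [symmetric]
    by (intro arg_cong [where f = uminus] arg_cong [where f = exp]) (simp add: algebra_simps)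
  then have "exp (k * \<tau>) * e = e * exp (- (2 * of_real pi * \<i> * a))"
    using mult [OF theta_11_add_tau theta_11_add_tau] by (simp only: e_def)
  then have "exp (k * \<tau>) = exp (- (2 * of_real pi * \<i> * a))"
    by (simp add: e_def)
  moreover have "2 * of_real pi * \<i> * (of_int m * \<tau> + a) = k * \<tau> + 2 * of_real pi * \<i> * a"
    by (simp add: m distrib_left mult.assoc)
  ultimately have "exp (2 * of_real pi * \<i> * (of_int m * \<tau> + a)) =
      exp (- (2 * of_real pi * \<i> * a)) * exp (2 * of_real pi * \<i> * a)"
    by (simp only: exp_add)
  then have "exp (2 * of_real pi * \<i> * (of_int m * \<tau> + a)) = 1"
    by (simp only: flip: exp_add) simp
  then obtain n :: int where "2 * of_real pi * \<i> * (of_int m * \<tau> + a) = 2 * of_real pi * \<i> * of_int n"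
    using exp_eq_1_imp_int by blast
  then have "of_int m * \<tau> + a = of_int n"
    by simp
  then have "a = of_int (- m) * \<tau> + of_int n"
    by (simp add: eq_diff_eq add.commute flip: diff_conv_add_uminus)
  then show thesis
    by (rule that)
qed

lemma theta_const_nonzero:
  assumes "Im \<tau> > 0" and "(\<epsilon> - 1) / 2 \<notin> \<int> \<or> (\<epsilon>' - 1) / 2 \<notin> \<int>"
  shows "theta_const \<epsilon> \<epsilon>' \<tau> \<noteq> 0"
proof
  define a where "a = of_real ((\<epsilon> - 1) / 2) * \<tau> + of_real ((\<epsilon>' - 1) / 2)"
  assume "theta_const \<epsilon> \<epsilon>' \<tau> = 0"
  then have "theta 1 1 a \<tau> = 0"
    using theta_add_char [of 1 "\<epsilon> - 1" 1 "\<epsilon>' - 1" 0 \<tau>]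
    by (simp add: theta_const_def a_def)
  then obtain m n :: int where mn: "a = of_int m * \<tau> + of_int n"
    using theta_11_zeros [OF assms(1)] by blast
  have "Im a = (\<epsilon> - 1) / 2 * Im \<tau>" "Re a = (\<epsilon> - 1) / 2 * Re \<tau> + (\<epsilon>' - 1) / 2"
    by (simp_all add: a_def)
  moreover have "Im a = of_int m * Im \<tau>" "Re a = of_int m * Re \<tau> + of_int n"
    by (simp_all add: mn)
  ultimately have "(\<epsilon> - 1) / 2 = of_int m"
    and "(\<epsilon> - 1) / 2 * Re \<tau> + (\<epsilon>' - 1) / 2 = of_int m * Re \<tau> + of_int n"
    using assms(1) by auto
  then have "(\<epsilon> - 1) / 2 = of_int m" "(\<epsilon>' - 1) / 2 = of_int n"
    by simp_all
  then show False
    using assms(2) by (metis Ints_of_int)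
qed

section \<open>The two identities\<close>

theorem theorem5p9:
  fixes \<tau> :: complex
  assumes "Im \<tau> > 0"
  shows "theta_deriv (2/3) (2/3) \<tau> =
           1 / 3 * (theta_deriv 1 1 \<tau> * theta_const (1/3) (1/3) \<tau> ^ 3 /
             (theta_const (2/3) (2/3) \<tau> ^ 2 * theta_const 0 0 \<tau>)) \<and>
         theta_deriv (2/3) (4/3) \<tau> =
           1 / 3 * (theta_deriv 1 1 \<tau> * theta_const (1/3) (5/3) \<tau> ^ 3 /
             (theta_const (2/3) (4/3) \<tau> ^ 2 * theta_const 0 0 \<tau>))"
proof -
  (* The first characteristics 0 and 2/3 give (\<epsilon> - 1) / 2 = -1/2 and -1/6. *)
  have nonint: "x \<notin> \<int>" if "-1 < x" "x < 0" for x :: real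
    using that by (auto elim!: Ints_cases)
  have "theta_const 0 0 \<tau> \<noteq> 0" "theta_const (2/3) (2/3) \<tau> \<noteq> 0" "theta_const (2/3) (4/3) \<tau> \<noteq> 0"
    by (intro theta_const_nonzero [OF assms] disjI1 nonint; simp)+
  (* Both characteristics are triplicated with x = -1/3, for which 1 + 3 * x = 0; the term
     T 1 ^ 3 * T' 3 then disappears because theta 0 0 is even. *)
  moreover have "theta_deriv 1 1 \<tau> * theta_const (1/3) (1/3) \<tau> ^ 3 =
      3 * theta_deriv (2/3) (2/3) \<tau> * theta_const (2/3) (2/3) \<tau> ^ 2 * theta_const 0 0 \<tau>"
    using theta_deriv_triplication [OF assms, of "-1/3" "-1/3"] theta_deriv_00 [OF assms] by simp
  moreover have "theta_deriv 1 1 \<tau> * theta_const (1/3) (5/3) \<tau> ^ 3 =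
      3 * theta_deriv (2/3) (4/3) \<tau> * theta_const (2/3) (4/3) \<tau> ^ 2 * theta_const 0 0 \<tau>"
  proof -
    have "theta_const 0 2 = theta_const 0 0" "theta_deriv 0 2 = theta_deriv 0 0"
      by (intro ext; simp add: theta_const_def theta_deriv_def theta_02)+
    then show ?thesis
      using theta_deriv_triplication [OF assms, of "-1/3" "1/3"] theta_deriv_00 [OF assms] by simp
  qed
  ultimately show ?thesis
    by simp
qed

end
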